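(* The minimal degree $d_f(\mathcal{A})$ of a finite polynomial vector field fixing $\mathcal{A}$ is not determined by the combinatorial information of $\mathcal{A}$. That is, there exist two real line arrangements $\mathcal{A},\mathcal{A}'$ in $\mathbb{R}^2$ whose intersection posets $L(\mathcal{A})$ and $L(\mathcal{A}')$ are isomorphic, but $d_f(\mathcal{A})\neq d_f(\mathcal{A}')$.
   Context: A real line arrangement is a finite nonempty set $\mathcal{A}=\{L_1,\dots,L_n\}$ of distinct (affine) lines in $\mathbb{R}^2$. Its combinatorial information is the intersection poset $L(\mathcal{A})=\{L_i\cap L_j\neq\emptyset \mid L_i,L_j\in\mathcal{A}\}\cup\mathcal{A}$, partially ordered by reverse inclusion of subsets. A polynomial vector field is $\chi=P\partial_x+Q\partial_y$ with $P,Q\in\mathbb{R}[x,y]$; its degree is $\max\{\deg P,\deg Q\}$. A line $L$ with degree-one equation $\alpha_L=0$ is invariant by (fixed by) $\chi$ if it is invariant under the flow of $\chi$, equivalently if $\alpha_L$ divides $\chi\alpha_L$ in $\mathbb{R}[x,y]$. $\mathcal{D}(\mathcal{A})$ is the set of polynomial vector fields $\chi$ with $\chi\mathcal{Q}_{\mathcal{A}}\in(\mathcal{Q}_{\mathcal{A}})$, where $\mathcal{Q}_{\mathcal{A}}=\prod_{L\in\mathcal{A}}\alpha_L$; equivalently, the set of $\chi$ for which every line of $\mathcal{A}$ is invariant. $d_f(\mathcal{A})$ is the minimal degree of an element $\chi\in\mathcal{D}(\mathcal{A})$ such that only finitely many lines of $\mathbb{R}^2$ are invariant by $\chi$. *)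

theory Defs
  imports "HOL-Analysis.Analysis" "HOL-Computational_Algebra.Computational_Algebra"
begin

text \<open>
  The ring \<open>\<real>[x,y]\<close> is represented by \<open>real poly poly\<close>, with \<open>y\<close> as the outer and
  \<open>x\<close> as the inner variable: \<open>coeff (coeff f j) i\<close> is the coefficient of \<open>x^i y^j\<close>.
\<close>

definition eval2 :: "real poly poly \<Rightarrow> real \<times> real \<Rightarrow> real" where
  "eval2 f p = poly (poly f [:snd p:]) (fst p)"

text \<open>As for the library's \<open>degree\<close>, the zero polynomial has total degree 0.\<close>

definition total_degree :: "real poly poly \<Rightarrow> nat" where
  "total_degree f = (LEAST d. \<forall>i j. d < i + j \<longrightarrow> coeff (coeff f j) i = 0)"

definition partial_x :: "real poly poly \<Rightarrow> real poly poly" where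
  "partial_x f = map_poly pderiv f"

definition partial_y :: "real poly poly \<Rightarrow> real poly poly" where
  "partial_y f = pderiv f"


text \<open>The pair \<open>(P, Q)\<close> stands for the vector field \<open>P \<partial>\<^sub>x + Q \<partial>\<^sub>y\<close>.\<close>

type_synonym vector_field = "real poly poly \<times> real poly poly"

definition vf_apply :: "vector_field \<Rightarrow> real poly poly \<Rightarrow> real poly poly" where
  "vf_apply X f = fst X * partial_x f + snd X * partial_y f"

definition vf_degree :: "vector_field \<Rightarrow> nat" where
  "vf_degree X = max (total_degree (fst X)) (total_degree (snd X))"


definition is_line :: "(real \<times> real) set \<Rightarrow> bool" where
  "is_line L \<longleftrightarrow> affine L \<and> aff_dim L = 1"

definition is_equation_of :: "real poly poly \<Rightarrow> (real \<times> real) set \<Rightarrow> bool" where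
  "is_equation_of \<alpha> L \<longleftrightarrow> total_degree \<alpha> = 1 \<and> {p. eval2 \<alpha> p = 0} = L"

text \<open>
  The equation of a line is unique up to a nonzero constant factor, so the choice
  is immaterial below.
\<close>

definition line_equation :: "(real \<times> real) set \<Rightarrow> real poly poly" where
  "line_equation L = (SOME \<alpha>. is_equation_of \<alpha> L)"

text \<open>Invariance of \<open>L\<close> under the flow of \<open>X\<close>, in its algebraic form.\<close>

definition invariant_line :: "vector_field \<Rightarrow> (real \<times> real) set \<Rightarrow> bool" where
  "invariant_line X L \<longleftrightarrow> line_equation L dvd vf_apply X (line_equation L)"


definition line_arrangement :: "(real \<times> real) set set \<Rightarrow> bool" where
  "line_arrangement \<A> \<longleftrightarrow> finite \<A> \<and> \<A> \<noteq> {} \<and> (\<forall>L\<in>\<A>. is_line L)"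

definition intersection_poset :: "(real \<times> real) set set \<Rightarrow> (real \<times> real) set set" where
  "intersection_poset \<A> = {L \<inter> L' | L L'. L \<in> \<A> \<and> L' \<in> \<A> \<and> L \<inter> L' \<noteq> {}} \<union> \<A>"

text \<open>Both posets are ordered by reverse inclusion.\<close>

definition same_combinatorics :: "(real \<times> real) set set \<Rightarrow> (real \<times> real) set set \<Rightarrow> bool" where
  "same_combinatorics \<A> \<B> \<longleftrightarrow>
    (\<exists>\<phi>. bij_betw \<phi> (intersection_poset \<A>) (intersection_poset \<B>) \<and>
      (\<forall>S\<in>intersection_poset \<A>. \<forall>T\<in>intersection_poset \<A>. S \<supseteq> T \<longleftrightarrow> \<phi> S \<supseteq> \<phi> T))"

definition defining_poly :: "(real \<times> real) set set \<Rightarrow> real poly poly" where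
  "defining_poly \<A> = (\<Prod>L\<in>\<A>. line_equation L)"

definition log_fields :: "(real \<times> real) set set \<Rightarrow> vector_field set" where
  "log_fields \<A> = {X. defining_poly \<A> dvd vf_apply X (defining_poly \<A>)}"

definition fixes_finitely_many_lines :: "vector_field \<Rightarrow> bool" where
  "fixes_finitely_many_lines X \<longleftrightarrow> finite {L. is_line L \<and> invariant_line X L}"

definition d_f :: "(real \<times> real) set set \<Rightarrow> nat" where
  "d_f \<A> = (LEAST d. \<exists>X\<in>log_fields \<A>. fixes_finitely_many_lines X \<and> vf_degree X = d)"

lemma eval2_simps [simp]:
  "eval2 0 p = 0" "eval2 1 p = 1" "eval2 (f * g) p = eval2 f p * eval2 g p"
  "eval2 (f + g) p = eval2 f p + eval2 g p"
  by (simp_all add: eval2_def)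

lemma eval2_prod: "eval2 (prod f A) p = (\<Prod>a\<in>A. eval2 (f a) p)"
  by (induction A rule: infinite_finite_induct) auto

lemma total_degree_le:
  assumes "\<And>i j. d < i + j \<Longrightarrow> coeff (coeff f j) i = 0"
  shows "total_degree f \<le> d"
  unfolding total_degree_def by (rule Least_le) (use assms in auto)

lemma coeff_above_total_degree:
  assumes "total_degree f < i + j"
  shows "coeff (coeff f j) i = 0"
proof -
  define D where "D = degree f + (\<Sum>k\<le>degree f. degree (coeff f k))"
  have "\<forall>i j. D < i + j \<longrightarrow> coeff (coeff f j) i = 0"
  proof (intro allI impI)
    fix i j assume ij: "D < i + j"
    show "coeff (coeff f j) i = 0"
    proof (cases "j \<le> degree f")
      case True
      then have "degree (coeff f j) \<le> (\<Sum>k\<le>degree f. degree (coeff f k))"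
        by (intro member_le_sum) auto
      with ij True have "degree (coeff f j) < i"
        by (simp add: D_def)
      then show ?thesis
        by (rule coeff_eq_0)
    qed (simp add: coeff_eq_0)
  qed
  then have "\<forall>i j. total_degree f < i + j \<longrightarrow> coeff (coeff f j) i = 0"
    unfolding total_degree_def by (rule LeastI)
  with assms show ?thesis by blast
qed

lemma total_degree_linear:
  assumes "a \<noteq> 0 \<or> b \<noteq> 0"
  shows "total_degree [:[:c, a:], [:b:]:] = 1"
proof (rule antisym)
  show "total_degree [:[:c, a:], [:b:]:] \<le> 1"
    by (rule total_degree_le) (auto simp: coeff_pCons split: nat.splits)
  show "1 \<le> total_degree [:[:c, a:], [:b:]:]"
  proof (rule ccontr)
    assume "\<not> 1 \<le> total_degree [:[:c, a:], [:b:]:]"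
    then have z: "total_degree [:[:c, a:], [:b:]:] = 0" by simp
    show False
      using assms coeff_above_total_degree[of "[:[:c, a:], [:b:]:]" 1 0]
        coeff_above_total_degree[of "[:[:c, a:], [:b:]:]" 0 1] unfolding z by auto
  qed
qed

lemma total_degree_1E:
  assumes "total_degree f = 1"
  obtains a b c where "f = [:[:c, a:], [:b:]:]" "a \<noteq> 0 \<or> b \<noteq> 0"
proof -
  define a b c where "a = coeff (coeff f 0) 1" and "b = coeff (coeff f 1) 0"
    and "c = coeff (coeff f 0) 0"
  have "coeff (coeff f j) i = coeff (coeff [:[:c, a:], [:b:]:] j) i" for i j
    using coeff_above_total_degree[of f i j] assms
    by (auto simp: a_def b_def c_def coeff_pCons split: nat.splits)
  then have f: "f = [:[:c, a:], [:b:]:]"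
    by (intro poly_eqI) auto
  have "a \<noteq> 0 \<or> b \<noteq> 0"
  proof (rule ccontr)
    assume "\<not> (a \<noteq> 0 \<or> b \<noteq> 0)"
    then have "total_degree f \<le> 0"
      unfolding f by (intro total_degree_le) (auto simp: coeff_pCons split: nat.splits)
    with assms show False by simp
  qed
  with f show thesis by (rule that)
qed

lemma eval2_linear: "eval2 [:[:c, a:], [:b:]:] p = a * fst p + b * snd p + c"
  by (simp add: eval2_def algebra_simps)

text \<open>Every line has an equation, so the choice in \<open>line_equation\<close> is a genuine one.\<close>

lemma line_equation:
  assumes "is_line L"
  shows "is_equation_of (line_equation L) L"
proof -
  have "aff_dim L = DIM(real \<times> real) - 1" "affine hull L = L"
    using assms by (simp_all add: is_line_def affine_hull_eq)
  then obtain n d where n: "n \<noteq> 0" and L: "L = {p. n \<bullet> p = d}"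
    unfolding aff_dim_eq_hyperplane by metis
  have "is_equation_of [:[:- d, fst n:], [:snd n:]:] L"
    using n by (auto simp: is_equation_of_def L eval2_linear total_degree_linear inner_prod_def
        prod_eq_iff)
  then show ?thesis
    unfolding line_equation_def by (rule someI)
qed

lemma line_equationE:
  assumes "is_line L"
  obtains a b c where "line_equation L = [:[:c, a:], [:b:]:]" "a \<noteq> 0 \<or> b \<noteq> 0"
    "L = {p. a * fst p + b * snd p + c = 0}"
  using line_equation[OF assms] unfolding is_equation_of_def
  by (metis (no_types, lifting) Collect_cong eval2_linear total_degree_1E)

lemma infinite_line:
  assumes "is_line L"
  shows "infinite L"
proof
  assume "finite L"
  moreover have "connected L"
    using assms affine_imp_convex convex_connected by (auto simp: is_line_def)
  ultimately have "L = {} \<or> (\<exists>x. L = {x})"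
    using connected_finite_iff_sing by blast
  then show False
    using assms by (auto simp: is_line_def)
qed

lemma lines_eqI:
  assumes "is_line L" "is_line L'" "infinite (L \<inter> L')"
  shows "L = L'"
proof -
  have aff: "affine L" "affine L'" "affine (L \<inter> L')" "aff_dim L = 1" "aff_dim L' = 1"
    using assms by (auto simp: is_line_def affine_Int)
  have "\<not> aff_dim (L \<inter> L') < 0" "aff_dim (L \<inter> L') \<noteq> 0"
    using assms(3) unfolding aff_dim_negative_iff aff_dim_eq_0 by auto
  moreover have "aff_dim (L \<inter> L') \<le> 1"
    using aff_dim_subset[of "L \<inter> L'" L] aff by simp
  ultimately have "aff_dim (L \<inter> L') = 1"
    by linarith
  moreover have "L \<inter> L' \<noteq> {}"
    using assms(3) by auto
  ultimately have "L \<inter> L' = L" and "L \<inter> L' = L'"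
    using aff by (metis affine_dim_equal inf_le1, metis affine_dim_equal inf_le2)
  then show ?thesis by blast
qed

text \<open>
  The minimum in \<open>d_f\<close> is over a nonempty set: a multiple of \<open>\<partial>\<^sub>x + x \<partial>\<^sub>y\<close>,
  a field with no invariant line, lies in \<open>log_fields \<A>\<close>.
\<close>

lemma ex_finite_log_field:
  assumes "line_arrangement \<A>"
  shows "\<exists>X\<in>log_fields \<A>. fixes_finitely_many_lines X"
proof -
  define Q where "Q = defining_poly \<A>"
  define X :: vector_field where "X = (Q, Q * [:[:0, 1:]:])"
  have fin: "finite \<A>" and lines: "\<And>L. L \<in> \<A> \<Longrightarrow> is_line L"
    using assms by (auto simp: line_arrangement_def)
  have "X \<in> log_fields \<A>"
    unfolding log_fields_def X_def vf_apply_def Q_def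
    by (auto intro!: dvd_add dvd_smult)
  moreover have "{L. is_line L \<and> invariant_line X L} \<subseteq> \<A>"
  proof safe
    fix L assume L: "is_line L" and inv: "invariant_line X L"
    obtain a b c where e: "line_equation L = [:[:c, a:], [:b:]:]" and ab: "a \<noteq> 0 \<or> b \<noteq> 0"
      and Leq: "L = {p. a * fst p + b * snd p + c = 0}"
      using line_equationE[OF L] .
    have ap: "eval2 (vf_apply X (line_equation L)) p = eval2 Q p * (a + b * fst p)" for p
      unfolding e vf_apply_def X_def partial_x_def partial_y_def
      by (simp add: map_poly_pCons pderiv_pCons algebra_simps) (simp add: eval2_def)
    have "eval2 Q p * (a + b * fst p) = 0" if "p \<in> L" for p
    proof -
      obtain K where K: "vf_apply X (line_equation L) = line_equation L * K"
        using inv by (auto simp: invariant_line_def)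
      have "eval2 (line_equation L) p = 0"
        using line_equation[OF L] that by (auto simp: is_equation_of_def)
      then show ?thesis
        unfolding ap[symmetric] K by simp
    qed
    moreover have "\<exists>M\<in>\<A>. p \<in> M" if Qp: "eval2 Q p = 0" for p
    proof -
      obtain M where "M \<in> \<A>" "eval2 (line_equation M) p = 0"
        using Qp fin by (auto simp: Q_def defining_poly_def eval2_prod)
      then show ?thesis
        using line_equation[OF lines] by (auto simp: is_equation_of_def)
    qed
    ultimately have "L \<subseteq> (\<Union>M\<in>\<A>. L \<inter> M) \<union> {p\<in>L. a + b * fst p = 0}"
      by fastforce
    moreover have "{p\<in>L. a + b * fst p = 0} \<subseteq> {(- a / b, (- a * (- a / b) - c) / b)}"
    proof
      fix p assume "p \<in> {p\<in>L. a + b * fst p = 0}"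
      then have p: "a * fst p + b * snd p + c = 0" "a + b * fst p = 0"
        by (auto simp: Leq)
      with ab have "b \<noteq> 0" by auto
      with p(2) have x: "fst p = - a / b"
        by (simp add: field_simps)
      moreover have "snd p = (- a * fst p - c) / b"
        using p(1) \<open>b \<noteq> 0\<close> by (simp add: field_simps)
      ultimately show "p \<in> {(- a / b, (- a * (- a / b) - c) / b)}"
        by (simp add: prod_eq_iff)
    qed
    ultimately have "infinite (\<Union>M\<in>\<A>. L \<inter> M)"
      using infinite_line[OF L] by (meson finite.emptyI finite.insertI finite_UnI finite_subset)
    then obtain M where "M \<in> \<A>" "infinite (L \<inter> M)"
      using finite_UN_I[OF fin] by metis
    with lines_eqI[OF L lines] show "L \<in> \<A>"
      by blast
  qed
  then have "fixes_finitely_many_lines X"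
    unfolding fixes_finitely_many_lines_def using fin finite_subset by blast
  ultimately show ?thesis by blast
qed

end

theory Submission imports Defs begin

text \<open>
  For real \<open>t\<close> consider the lines \<open>y = 0\<close>, \<open>y = t\<close>, \<open>y = x\<close>, \<open>y = x - 1\<close>, \<open>y = t x\<close> together with
  the verticals \<open>x = 1\<close>, \<open>x = t\<close>, \<open>(1 - t) x = 1\<close>. The three verticals carry every crossing of the
  five other lines, except the triple point \<open>(0, 0)\<close> and the double point \<open>(1 + t, t)\<close>.
  If \<open>P \<partial>\<^sub>x + Q \<partial>\<^sub>y\<close> fixes the arrangement, then \<open>P\<close> is divisible by the equations of the verticals;
  the cofactor \<open>p\<close> vanishes at both exceptional points, and \<open>\<partial>\<^sub>y p\<close> vanishes at the triple point.
  In degree at most 4 the cofactor has degree at most 1, so \<open>p = 0\<close> unless the two points lie on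
  a common vertical, which means \<open>t = -1\<close>; and \<open>P = 0\<close> makes every vertical line invariant.
  The combinatorics does not see this condition: \<open>t = -1\<close> and \<open>t = 2\<close> give isomorphic posets.
\<close>

subsection \<open>Invariant lines\<close>

text \<open>Coefficient triples turn statements about lines into arithmetic. A triple with
  \<open>a = b = 0\<close> gives the empty set or the whole plane, hence the recurring side
  condition.\<close>

definition line_of :: "real \<times> real \<times> real \<Rightarrow> (real \<times> real) set" where
  "line_of = (\<lambda>(a, b, c). {p. a * fst p + b * snd p + c = 0})"

lemma mem_line_of [simp]: "(x, y) \<in> line_of (a, b, c) \<longleftrightarrow> a * x + b * y + c = 0"
  by (simp add: line_of_def)

lemma ball_line_of:
  "b \<noteq> 0 \<Longrightarrow> (\<forall>p\<in>line_of (a, b, c). \<phi> p) \<longleftrightarrow> (\<forall>x. \<phi> (x, (- a * x - c) / b))"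
  "a \<noteq> 0 \<Longrightarrow> (\<forall>p\<in>line_of (a, 0, c). \<phi> p) \<longleftrightarrow> (\<forall>y. \<phi> (- c / a, y))"
proof -
  show "(\<forall>p\<in>line_of (a, b, c). \<phi> p) \<longleftrightarrow> (\<forall>x. \<phi> (x, (- a * x - c) / b))" if "b \<noteq> 0"
  proof -
    have "(x, y) \<in> line_of (a, b, c) \<longleftrightarrow> y = (- a * x - c) / b" for x y
      unfolding mem_line_of using that by (auto simp: field_simps)
    then show ?thesis by (simp add: Ball_def)
  qed
  show "(\<forall>p\<in>line_of (a, 0, c). \<phi> p) \<longleftrightarrow> (\<forall>y. \<phi> (- c / a, y))" if "a \<noteq> 0"
  proof -
    have "(x, y) \<in> line_of (a, 0, c) \<longleftrightarrow> x = - c / a" for x y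
      unfolding mem_line_of using that by (auto simp: field_simps)
    then show ?thesis by (simp add: Ball_def)
  qed
qed

lemma is_line_line_of:
  assumes "a \<noteq> 0 \<or> b \<noteq> 0"
  shows "is_line (line_of (a, b, c))"
proof -
  have eq: "line_of (a, b, c) = {p. (a, b) \<bullet> p = - c}"
    by (simp add: line_of_def inner_prod_def eq_neg_iff_add_eq_0)
  have nz: "(a, b) \<noteq> 0"
    using assms by (simp add: zero_prod_def)
  have "aff_dim {p. (a, b) \<bullet> p = - c} = int (DIM(real \<times> real) - 1)"
    by (rule aff_dim_hyperplane[OF nz])
  then show ?thesis
    unfolding is_line_def eq using affine_hyperplane by simp
qed

lemma is_lineE:
  assumes "is_line L"
  obtains a b c where "L = line_of (a, b, c)" "a \<noteq> 0 \<or> b \<noteq> 0"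
proof -
  obtain a b c where "line_equation L = [:[:c, a:], [:b:]:]" "a \<noteq> 0 \<or> b \<noteq> 0"
    "L = {p. a * fst p + b * snd p + c = 0}"
    using line_equationE[OF assms] .
  then show thesis
    using that[of a b c] by (simp add: line_of_def)
qed

lemma eval2_pCons: "eval2 (pCons g f) p = poly g (fst p) + snd p * eval2 f p"
  by (simp add: eval2_def)

text \<open>Restriction to a parametrised line lands in \<open>\<real>[s]\<close>, where infinitely
  many zeros force the zero polynomial.\<close>

lemma eval2_along_line: "\<exists>q. \<forall>s. eval2 f (x + s * u, y + s * v) = poly q s"
proof (induction f)
  case 0
  show ?case by (rule exI[of _ 0]) simp
next
  case (pCons g f)
  then obtain q where q: "\<And>s. eval2 f (x + s * u, y + s * v) = poly q s" by blast
  show ?case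
    by (rule exI[of _ "pcompose g [:x, u:] + [:y, v:] * q"])
      (simp add: eval2_pCons q poly_pcompose algebra_simps)
qed

lemma eval2_graph: "eval2 f (x, m * x + k) = poly (poly f [:k, m:]) x"
  by (induction f) (simp_all add: eval2_pCons algebra_simps)

lemma eval2_vertical: "eval2 f (c, y) = poly (map_poly (\<lambda>g. poly g c) f) y"
  by (induction f) (simp_all add: eval2_pCons map_poly_pCons)

lemma vertical_zeros_coeff:
  assumes "\<And>y. eval2 f (c, y) = 0"
  shows "poly (coeff f j) c = 0"
proof -
  have "map_poly (\<lambda>g. poly g c) f = 0"
    using assms by (intro iffD1[OF poly_all_0_iff_0]) (simp add: eval2_vertical)
  then have "coeff (map_poly (\<lambda>g. poly g c) f) j = 0" by simp
  then show ?thesis by (simp add: coeff_map_poly)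
qed

text \<open>The Nullstellensatz for a line. If \<open>b = 0\<close>, the root \<open>- c / a\<close>
  splits off from every coefficient in \<open>\<real>[x]\<close>; otherwise \<open>f\<close>, as a
  polynomial in y over \<open>\<real>[x]\<close>, has the root \<open>l\<close>, and the factor
  theorem applies.\<close>

lemma linear_dvd_if_vanishes:
  assumes "a \<noteq> 0 \<or> b \<noteq> 0" and van: "\<And>p. p \<in> line_of (a, b, c) \<Longrightarrow> eval2 f p = 0"
  shows "[:[:c, a:], [:b:]:] dvd f"
proof (cases "b = 0")
  case True
  with assms have a: "a \<noteq> 0" by simp
  have "eval2 f (- c / a, y) = 0" for y
    using a True by (intro van) simp
  then have "poly (coeff f j) (- c / a) = 0" for j
    by (rule vertical_zeros_coeff)
  then have "[:c / a, 1:] dvd coeff f j" for j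
    by (simp add: poly_eq_0_iff_dvd)
  moreover have "[:c, a:] = smult a [:c / a, 1:]"
    using a by simp
  ultimately have "[:c, a:] dvd coeff f j" for j
    using a by (metis smult_dvd)
  then show ?thesis
    using True by (simp add: const_poly_dvd_iff)
next
  case False
  define l where "l = [:- c / b, - a / b:]"
  have "eval2 f (x, (- a / b) * x + (- c / b)) = 0" for x
    using False by (intro van) (simp add: field_simps)
  then have "poly (poly f l) x = 0" for x
    unfolding l_def eval2_graph .
  then have "poly f l = 0"
    using poly_all_0_iff_0 by blast
  then obtain h where "f = [:- l, 1:] * h"
    by (auto simp: poly_eq_0_iff_dvd dvd_def)
  moreover have "[:- l, 1:] = smult [:1 / b:] [:[:c, a:], [:b:]:]"
    using False by (simp add: l_def)
  ultimately have "f = [:[:c, a:], [:b:]:] * smult [:1 / b:] h"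
    by (simp only: mult_smult_left mult_smult_right)
  then show ?thesis by (rule dvdI)
qed

lemma vf_apply_linear:
  "vf_apply X [:[:c, a:], [:b:]:] = smult [:a:] (fst X) + smult [:b:] (snd X)"
  by (simp add: vf_apply_def partial_x_def partial_y_def map_poly_pCons pderiv_pCons)

lemma eval2_smult: "eval2 (smult g f) p = poly g (fst p) * eval2 f p"
  by (simp add: eval2_def)

text \<open>The chosen \<open>line_equation\<close> is known only up to a nonzero factor; this
  factor \<open>k\<close> depends on the line alone, not on the field or the point.\<close>

lemma eval2_vf_apply_line_equation:
  assumes "a \<noteq> 0 \<or> b \<noteq> 0"
  shows "\<exists>k. k \<noteq> 0 \<and> (\<forall>X p. eval2 (vf_apply X (line_equation (line_of (a, b, c)))) p =
       k * (a * eval2 (fst X) p + b * eval2 (snd X) p))"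
proof -
  obtain a' b' c' where e: "line_equation (line_of (a, b, c)) = [:[:c', a':], [:b':]:]"
    and ab': "a' \<noteq> 0 \<or> b' \<noteq> 0"
    and "line_of (a, b, c) = {p. a' * fst p + b' * snd p + c' = 0}"
    using line_equationE[OF is_line_line_of[OF assms]] .
  then have eq: "a * x + b * y + c = 0 \<longleftrightarrow> a' * x + b' * y + c' = 0" for x y
    by (auto simp: line_of_def set_eq_iff)
  obtain x y where xy: "a * x + b * y + c = 0"
    using assms by (metis add.left_inverse add_0 mult_zero_left nonzero_mult_div_cancel_left
        times_divide_eq_right add_0_right)
  \<comment> \<open>A second point, displaced by the direction (-b, a). Two common points make the
    normals proportional.\<close>
  have "a * (x - b) + b * (y + a) + c = 0"
    using xy by (simp add: algebra_simps)
  then have "a' * (x - b) + b' * (y + a) + c' = 0" "a' * x + b' * y + c' = 0"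
    using eq xy by blast+
  then have cross: "a * b' = a' * b"
    by (simp add: algebra_simps)
  define k where "k = (if a = 0 then b' / b else a' / a)"
  have k: "a' = k * a" "b' = k * b"
    using assms cross by (auto simp: k_def field_simps)
  then have "k \<noteq> 0" using ab' by auto
  moreover have "eval2 (vf_apply X (line_equation (line_of (a, b, c)))) p =
       k * (a * eval2 (fst X) p + b * eval2 (snd X) p)" for X p
    unfolding e vf_apply_linear k by (simp add: eval2_smult algebra_simps)
  ultimately show ?thesis by blast
qed

lemma line_equation_dvd_iff:
  assumes "is_line L"
  shows "line_equation L dvd f \<longleftrightarrow> (\<forall>p\<in>L. eval2 f p = 0)"
proof
  assume "line_equation L dvd f"
  then show "\<forall>p\<in>L. eval2 f p = 0"
    using line_equation[OF assms] by (auto simp: is_equation_of_def dvd_def)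
next
  assume van: "\<forall>p\<in>L. eval2 f p = 0"
  obtain a b c where e: "line_equation L = [:[:c, a:], [:b:]:]" and ab: "a \<noteq> 0 \<or> b \<noteq> 0"
    and L: "L = {p. a * fst p + b * snd p + c = 0}"
    using line_equationE[OF assms] .
  have "L = line_of (a, b, c)"
    by (simp add: L line_of_def)
  with van show "line_equation L dvd f"
    unfolding e by (intro linear_dvd_if_vanishes ab) blast
qed

lemma invariant_line_of_iff:
  assumes "a \<noteq> 0 \<or> b \<noteq> 0"
  shows "invariant_line X (line_of (a, b, c)) \<longleftrightarrow>
    (\<forall>p\<in>line_of (a, b, c). a * eval2 (fst X) p + b * eval2 (snd X) p = 0)"
proof -
  obtain k where "k \<noteq> 0"
    "\<And>X p. eval2 (vf_apply X (line_equation (line_of (a, b, c)))) p =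
       k * (a * eval2 (fst X) p + b * eval2 (snd X) p)"
    using eval2_vf_apply_line_equation[OF assms, of c] by blast
  then show ?thesis
    by (simp add: invariant_line_def line_equation_dvd_iff[OF is_line_line_of[OF assms]])
qed

subsection \<open>Logarithmic vector fields\<close>

lemma partial_x_add: "partial_x (f + g) = partial_x f + partial_x g"
  unfolding partial_x_def by (rule poly_eqI) (simp add: coeff_map_poly pderiv_add)

lemma partial_x_pCons: "partial_x (pCons g f) = pCons (pderiv g) (partial_x f)"
  by (simp add: partial_x_def map_poly_pCons)

lemma partial_x_smult: "partial_x (smult g f) = smult (pderiv g) f + smult g (partial_x f)"
  by (rule poly_eqI) (simp add: partial_x_def coeff_map_poly pderiv_mult algebra_simps)

lemma partial_x_mult: "partial_x (f * g) = partial_x f * g + f * partial_x g"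
proof (induction f)
  case 0
  show ?case by (simp add: partial_x_def)
next
  case (pCons a f)
  then show ?case
    by (simp add: partial_x_add partial_x_smult partial_x_pCons algebra_simps)
qed

lemma vf_apply_mult: "vf_apply X (f * g) = f * vf_apply X g + g * vf_apply X f"
  by (simp add: vf_apply_def partial_x_mult partial_y_def pderiv_mult algebra_simps)

text \<open>In effect the equation of a line is prime: on the line, \<open>f\<close> and
  \<open>g\<close> become polynomials in one parameter, and \<open>\<real>[s]\<close> has no zero
  divisors.\<close>

lemma vanishes_on_line_mult:
  assumes "is_line L" "\<And>p. p \<in> L \<Longrightarrow> eval2 (f * g) p = 0"
  shows "(\<forall>p\<in>L. eval2 f p = 0) \<or> (\<forall>p\<in>L. eval2 g p = 0)"
proof -
  obtain a b c where L: "L = line_of (a, b, c)" and ab: "a \<noteq> 0 \<or> b \<noteq> 0"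
    using is_lineE[OF assms(1)] .
  obtain x y where xy: "(x, y) \<in> L"
    using infinite_line[OF assms(1)] by (metis finite.emptyI equals0I surj_pair)
  have on: "(x + s * b, y + s * (- a)) \<in> L" for s
    using xy by (simp add: L algebra_simps)
  have param: "\<exists>s. p = (x + s * b, y + s * (- a))" if "p \<in> L" for p
  proof -
    obtain u v where p: "p = (u, v)" by (cases p)
    have e: "a * (u - x) = b * (y - v)"
      using that xy by (simp add: p L algebra_simps)
    show ?thesis
    proof (cases "b = 0")
      case True
      with ab e have "u = x" "a \<noteq> 0" by auto
      then show ?thesis
        using True by (intro exI[of _ "(y - v) / a"]) (simp add: p)
    next
      case False
      then show ?thesis
        using e by (intro exI[of _ "(u - x) / b"]) (simp add: p field_simps)
    qed
  qed
  obtain q where q: "\<And>s. eval2 f (x + s * b, y + s * (- a)) = poly q s"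
    using eval2_along_line[of f x b y "- a"] by blast
  obtain r where r: "\<And>s. eval2 g (x + s * b, y + s * (- a)) = poly r s"
    using eval2_along_line[of g x b y "- a"] by blast
  have "poly (q * r) s = 0" for s
    using assms(2)[OF on[of s]] q[of s] r[of s] by simp
  then have "q * r = 0"
    using poly_all_0_iff_0 by blast
  then have "q = 0 \<or> r = 0" by simp
  then show ?thesis
    using q r param by (metis poly_0)
qed

text \<open>Both directions rest on the Leibniz rule. From left to right, the equation of
  \<open>L\<close> divides \<open>R * vf_apply X (line_equation L)\<close>, where \<open>R\<close>
  is the product of the other equations, and primality removes \<open>R\<close>.\<close>

lemma log_fields_iff:
  assumes "line_arrangement \<A>"
  shows "X \<in> log_fields \<A> \<longleftrightarrow> (\<forall>L\<in>\<A>. invariant_line X L)"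
proof
  have fin: "finite \<A>" and lines: "\<And>L. L \<in> \<A> \<Longrightarrow> is_line L"
    using assms by (auto simp: line_arrangement_def)
  show "\<forall>L\<in>\<A>. invariant_line X L" if X: "X \<in> log_fields \<A>"
  proof
    fix L assume L: "L \<in> \<A>"
    define R where "R = (\<Prod>M\<in>\<A> - {L}. line_equation M)"
    have "defining_poly \<A> = line_equation L * R"
      unfolding defining_poly_def R_def using fin L by (rule prod.remove)
    with X have "line_equation L * R dvd
        line_equation L * vf_apply X R + R * vf_apply X (line_equation L)"
      by (simp add: log_fields_def vf_apply_mult)
    then have "line_equation L dvd R * vf_apply X (line_equation L)"
      by (metis dvd_add_right_iff dvd_mult_left dvd_triv_left)
    then have "(\<forall>p\<in>L. eval2 R p = 0) \<or> (\<forall>p\<in>L. eval2 (vf_apply X (line_equation L)) p = 0)"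
      using vanishes_on_line_mult[OF lines[OF L]] line_equation_dvd_iff[OF lines[OF L]] by blast
    \<comment> \<open>If \<open>R\<close> vanished along \<open>L\<close>, finitely many other lines
      would cover the infinite set \<open>L\<close>, so one of them would coincide with
      \<open>L\<close>.\<close>
    moreover have False if "\<forall>p\<in>L. eval2 R p = 0"
    proof -
      have "L \<subseteq> (\<Union>M\<in>\<A> - {L}. L \<inter> M)"
      proof
        fix p assume p: "p \<in> L"
        with that have "eval2 R p = 0" by blast
        then obtain M where "M \<in> \<A> - {L}" "eval2 (line_equation M) p = 0"
          using fin by (auto simp: R_def eval2_prod)
        with p show "p \<in> (\<Union>M\<in>\<A> - {L}. L \<inter> M)"
          using line_equation[OF lines[of M]] by (auto simp: is_equation_of_def)
      qed
      then have "infinite (\<Union>M\<in>\<A> - {L}. L \<inter> M)"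
        using infinite_line[OF lines[OF L]] finite_subset by blast
      then obtain M where "M \<in> \<A> - {L}" "infinite (L \<inter> M)"
        using fin by blast
      with lines_eqI[OF lines[OF L] lines[of M]] show False by blast
    qed
    ultimately show "invariant_line X L"
      using line_equation_dvd_iff[OF lines[OF L]] by (auto simp: invariant_line_def)
  qed
  show "X \<in> log_fields \<A>" if inv: "\<forall>L\<in>\<A>. invariant_line X L"
  proof -
    have "(\<Prod>L\<in>\<A>. line_equation L) dvd vf_apply X (\<Prod>L\<in>\<A>. line_equation L)"
      using fin inv
    proof (induction \<A>)
      case empty
      show ?case by simp
    next
      case (insert L \<B>)
      then show ?case
        by (auto simp: vf_apply_mult invariant_line_def mult.commute intro!: dvd_add mult_dvd_mono)
    qed
    then show ?thesis by (simp add: log_fields_def defining_poly_def)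
  qed
qed

subsection \<open>Fields with finitely many invariant lines\<close>

lemma finite_zeros_on_line:
  assumes "eval2 f (x + s0 * u, y + s0 * v) \<noteq> 0"
  shows "finite {s. eval2 f (x + s * u, y + s * v) = 0}"
proof -
  obtain q where q: "\<And>s. eval2 f (x + s * u, y + s * v) = poly q s"
    using eval2_along_line[of f x u y v] by blast
  with assms have "q \<noteq> 0" by auto
  then show ?thesis by (simp add: q poly_roots_finite)
qed

text \<open>
  The field is vertical along \<open>x = c\<close> and \<open>x = d\<close>, so a non-vertical invariant line meets them
  in zeros of \<open>Q\<close>, and it is determined by these two points.
\<close>

lemma fixes_finitely_many_linesI:
  assumes "c \<noteq> d" and Pc: "\<And>y. eval2 P (c, y) = 0" and Pd: "\<And>y. eval2 P (d, y) = 0"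
    and Qc: "eval2 Q (c, u) \<noteq> 0" and Qd: "eval2 Q (d, v) \<noteq> 0" and P: "eval2 P (x0, y0) \<noteq> 0"
  shows "fixes_finitely_many_lines (P, Q)"
proof -
  define Zc where "Zc = {y. eval2 Q (c, y) = 0}"
  define Zd where "Zd = {y. eval2 Q (d, y) = 0}"
  \<comment> \<open>An invariant vertical line \<open>x = r\<close> lies in the zeros of
    \<open>P\<close>; looking at height \<open>y0\<close> leaves finitely many r.\<close>
  define Z where "Z = {x. eval2 P (x, y0) = 0}"
  have fin: "finite Zc" "finite Zd" "finite Z"
    using finite_zeros_on_line[of Q c u 0 0 1] finite_zeros_on_line[of Q d v 0 0 1]
      finite_zeros_on_line[of P 0 x0 1 y0 0] Qc Qd P
    by (simp_all add: Zc_def Zd_def Z_def)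
  \<comment> \<open>The line through (c, y) and (d, z), in slope-intercept form.\<close>
  define g where "g = (\<lambda>(y, z). line_of ((z - y) / (d - c), - 1, y - (z - y) / (d - c) * c))"
  have "L \<in> (\<lambda>x. line_of (1, 0, - x)) ` Z \<union> g ` (Zc \<times> Zd)"
    if L: "is_line L" and inv: "invariant_line (P, Q) L" for L
  proof -
    obtain a b e where Le: "L = line_of (a, b, e)" and ab: "a \<noteq> 0 \<or> b \<noteq> 0"
      using is_lineE[OF L] .
    have tan: "a * eval2 P (x, y) + b * eval2 Q (x, y) = 0" if "a * x + b * y + e = 0" for x y
    proof -
      have "(x, y) \<in> line_of (a, b, e)" using that by simp
      then show ?thesis
        using inv unfolding Le invariant_line_of_iff[OF ab] by auto
    qed
    show ?thesis
    proof (cases "b = 0")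
      case True
      with ab have a: "a \<noteq> 0" by simp
      have "eval2 P (- e / a, y0) = 0"
        using tan[of "- e / a" y0] True a by simp
      moreover have "L = line_of (1, 0, - (- e / a))"
        using True a by (auto simp: Le line_of_def field_simps)
      ultimately show ?thesis
        unfolding Z_def by blast
    next
      case False
      define y where "y = - (a * c + e) / b"
      define z where "z = - (a * d + e) / b"
      have "y \<in> Zc" "z \<in> Zd"
        using tan[of c y] tan[of d z] False by (simp_all add: Zc_def Zd_def Pc Pd y_def z_def)
      moreover have "(z - y) / (d - c) = - a / b"
        using False assms(1) by (simp add: y_def z_def divide_simps) (simp add: algebra_simps)
      then have "g (y, z) = line_of (- a / b, - 1, y - (- a / b) * c)"
        by (simp only: g_def prod.case)
      moreover have "y - (- a / b) * c = - e / b"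
        using False by (simp add: y_def field_simps)
      moreover have "line_of (- a / b, - 1, - e / b) = L"
        using False by (auto simp: Le line_of_def field_simps)
      ultimately have "L = g (y, z)" by simp
      with \<open>y \<in> Zc\<close> \<open>z \<in> Zd\<close> show ?thesis by blast
    qed
  qed
  then have "{L. is_line L \<and> invariant_line (P, Q) L} \<subseteq>
      (\<lambda>x. line_of (1, 0, - x)) ` Z \<union> g ` (Zc \<times> Zd)"
    by blast
  then show ?thesis
    unfolding fixes_finitely_many_lines_def by (rule finite_subset) (simp add: fin)
qed

lemma fst_nonzero_if_finite:
  assumes "fixes_finitely_many_lines X"
  shows "fst X \<noteq> 0"
proof
  assume "fst X = 0"
  then have "range (\<lambda>x. line_of (1, 0, x)) \<subseteq> {L. is_line L \<and> invariant_line X L}"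
    by (auto simp: is_line_line_of invariant_line_of_iff)
  moreover have "inj (\<lambda>x. line_of (1, 0, x))"
  proof (rule injI)
    fix x x' assume "line_of (1, 0, x) = line_of (1, 0, x')"
    moreover have "(- x, 0) \<in> line_of (1, 0, x)" by simp
    ultimately have "(- x, 0) \<in> line_of (1, 0, x')" by metis
    then show "x = x'" by simp
  qed
  moreover from this have "infinite (range (\<lambda>x. line_of (1, 0, x)))"
    using finite_imageD infinite_UNIV_char_0 by blast
  ultimately have "infinite {L. is_line L \<and> invariant_line X L}"
    by (simp add: infinite_super)
  then show False
    using assms by (simp add: fixes_finitely_many_lines_def)
qed

subsection \<open>Comparing intersection posets\<close>

text \<open>An isomorphism of posets comes from matching lines by index, provided that the same
  pairs meet and the same lines pass through each meeting point.\<close>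

lemma same_combinatoricsI:
  assumes lines: "\<And>i. i \<in> I \<Longrightarrow> is_line (L i) \<and> is_line (M i)"
    and inj: "inj_on L I" "inj_on M I"
    and meet: "\<And>i j. i \<in> I \<Longrightarrow> j \<in> I \<Longrightarrow> L i \<inter> L j \<noteq> {} \<longleftrightarrow> M i \<inter> M j \<noteq> {}"
    and inc: "\<And>i j k. i \<in> I \<Longrightarrow> j \<in> I \<Longrightarrow> k \<in> I \<Longrightarrow> L i \<inter> L j \<noteq> {} \<Longrightarrow> i \<noteq> j \<Longrightarrow>
      L i \<inter> L j \<subseteq> L k \<longleftrightarrow> M i \<inter> M j \<subseteq> M k"
  shows "same_combinatorics (L ` I) (M ` I)"
proof -
  \<comment> \<open>A line is its intersection with itself, so pairwise intersections with
    \<open>i = j\<close> allowed exhaust the poset.\<close>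
  have poset: "intersection_poset (N ` I) = {N i \<inter> N j | i j. i \<in> I \<and> j \<in> I \<and> N i \<inter> N j \<noteq> {}}"
    if "\<And>i. i \<in> I \<Longrightarrow> is_line (N i)" for N :: "'a \<Rightarrow> (real \<times> real) set"
  proof -
    have "N i \<in> {N i \<inter> N j | i j. i \<in> I \<and> j \<in> I \<and> N i \<inter> N j \<noteq> {}}" if "i \<in> I" for i
      using infinite_line[OF \<open>\<And>i. i \<in> I \<Longrightarrow> is_line (N i)\<close>[OF that]] that
      by (auto intro!: exI[of _ i])
    then show ?thesis
      unfolding intersection_poset_def by blast
  qed
  have line_sub: "N i \<subseteq> N k \<longleftrightarrow> i = k"
    if "is_line (N i)" "is_line (N k)" "inj_on N I" "i \<in> I" "k \<in> I"
    for N :: "'a \<Rightarrow> (real \<times> real) set" and i k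
    using that lines_eqI[of "N i" "N k"] infinite_line[of "N i"]
    by (metis inf.absorb1 inj_onD subset_refl)
  have sup_iff: "L i \<inter> L j \<subseteq> L k \<longleftrightarrow> M i \<inter> M j \<subseteq> M k"
    if "i \<in> I" "j \<in> I" "k \<in> I" "L i \<inter> L j \<noteq> {}" for i j k
    using that inc line_sub[of L i k] line_sub[of M i k] lines inj by (cases "i = j") auto
  \<comment> \<open>Only the family of lines containing \<open>S\<close> enters, so the value does
    not depend on how \<open>S\<close> is written as an intersection.\<close>
  define \<phi> where "\<phi> S = \<Inter> {M k | k. k \<in> I \<and> S \<subseteq> L k}" for S
  have \<phi>: "\<phi> (L i \<inter> L j) = M i \<inter> M j" if "i \<in> I" "j \<in> I" "L i \<inter> L j \<noteq> {}" for i j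
    unfolding \<phi>_def using that sup_iff by fast
  have order: "L i \<inter> L j \<supseteq> L k \<inter> L l \<longleftrightarrow> M i \<inter> M j \<supseteq> M k \<inter> M l"
    if "i \<in> I" "j \<in> I" "k \<in> I" "l \<in> I" "L i \<inter> L j \<noteq> {}" "L k \<inter> L l \<noteq> {}" for i j k l
    using that sup_iff[of k l i] sup_iff[of k l j] by blast
  have PL: "intersection_poset (L ` I) = {L i \<inter> L j | i j. i \<in> I \<and> j \<in> I \<and> L i \<inter> L j \<noteq> {}}"
    and PM: "intersection_poset (M ` I) = {M i \<inter> M j | i j. i \<in> I \<and> j \<in> I \<and> M i \<inter> M j \<noteq> {}}"
    using poset lines by blast+
  have ord: "S \<supseteq> T \<longleftrightarrow> \<phi> S \<supseteq> \<phi> T"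
    if ST: "S \<in> intersection_poset (L ` I)" "T \<in> intersection_poset (L ` I)" for S T
  proof -
    obtain i j k l where "i \<in> I" "j \<in> I" "k \<in> I" "l \<in> I" "L i \<inter> L j \<noteq> {}" "L k \<inter> L l \<noteq> {}"
      "S = L i \<inter> L j" "T = L k \<inter> L l"
      using ST unfolding PL by blast
    then show ?thesis
      using order \<phi> by metis
  qed
  \<comment> \<open>An order embedding is injective by antisymmetry.\<close>
  have "inj_on \<phi> (intersection_poset (L ` I))"
    using ord by (intro inj_onI subset_antisym) simp_all
  moreover have "\<phi> ` intersection_poset (L ` I) = intersection_poset (M ` I)"
  proof (intro subset_antisym subsetI)
    fix T assume "T \<in> \<phi> ` intersection_poset (L ` I)"
    then obtain i j where ij: "i \<in> I" "j \<in> I" "L i \<inter> L j \<noteq> {}" and "T = \<phi> (L i \<inter> L j)"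
      unfolding PL by blast
    then have "T = M i \<inter> M j" "M i \<inter> M j \<noteq> {}"
      using \<phi>[OF ij] meet[OF ij(1,2)] by simp_all
    with ij show "T \<in> intersection_poset (M ` I)"
      unfolding PM by blast
  next
    fix T assume "T \<in> intersection_poset (M ` I)"
    then obtain i j where ij: "i \<in> I" "j \<in> I" "M i \<inter> M j \<noteq> {}" "T = M i \<inter> M j"
      unfolding PM by blast
    then have L: "L i \<inter> L j \<noteq> {}" using meet[OF ij(1,2)] by simp
    then have "T = \<phi> (L i \<inter> L j)" using ij \<phi> by simp
    moreover have "L i \<inter> L j \<in> intersection_poset (L ` I)"
      unfolding PL using ij L by blast
    ultimately show "T \<in> \<phi> ` intersection_poset (L ` I)" by blast
  qed
  ultimately have "bij_betw \<phi> (intersection_poset (L ` I)) (intersection_poset (M ` I))"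
    by (simp add: bij_betw_def)
  then show ?thesis
    unfolding same_combinatorics_def using ord by (intro exI[of _ \<phi>] conjI ballI)
qed

section \<open>Incidence computed from coefficients\<close>

definition cross :: "real \<times> real \<times> real \<Rightarrow> real \<times> real \<times> real \<Rightarrow> real" where
  "cross = (\<lambda>(a, b, c) (a', b', c'). a * b' - a' * b)"

definition parallel_distinct :: "real \<times> real \<times> real \<Rightarrow> real \<times> real \<times> real \<Rightarrow> bool" where
  "parallel_distinct = (\<lambda>(a, b, c) (a', b', c').
     a * b' = a' * b \<and> (a * c' \<noteq> a' * c \<or> b * c' \<noteq> b' * c))"

text \<open>The determinant of the 3 x 3 matrix with these rows, expanded along the third.\<close>

definition det3 ::
    "real \<times> real \<times> real \<Rightarrow> real \<times> real \<times> real \<Rightarrow> real \<times> real \<times> real \<Rightarrow> real" where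
  "det3 = (\<lambda>(a, b, c) (a', b', c') (a'', b'', c'').
     a'' * (b * c' - b' * c) - b'' * (a * c' - a' * c) + c'' * (a * b' - a' * b))"

lemma line_of_disjoint:
  assumes "parallel_distinct l m"
  shows "line_of l \<inter> line_of m = {}"
proof -
  obtain a b c a' b' c' where [simp]: "l = (a, b, c)" "m = (a', b', c')"
    by (metis prod_cases3)
  have par: "a * b' = a' * b" and dist: "a * c' \<noteq> a' * c \<or> b * c' \<noteq> b' * c"
    using assms by (auto simp: parallel_distinct_def)
  have False if "a * x + b * y + c = 0" "a' * x + b' * y + c' = 0" for x y
  proof -
    have "a * c' = a' * c" "b * c' = b' * c"
      using that par by algebra+
    with dist show False by blast
  qed
  then show ?thesis by (auto simp: line_of_def)
qed

text \<open>Cramer's rule.\<close>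

lemma line_of_Int:
  assumes "cross (a, b, c) (a', b', c') \<noteq> 0"
  shows "line_of (a, b, c) \<inter> line_of (a', b', c') =
    {((b * c' - b' * c) / (a * b' - a' * b), (a' * c - a * c') / (a * b' - a' * b))}"
proof -
  have D: "a * b' - a' * b \<noteq> 0"
    using assms by (simp add: cross_def)
  have eq: "a * x + b * y + c = 0 \<and> a' * x + b' * y + c' = 0 \<longleftrightarrow>
      x * (a * b' - a' * b) = b * c' - b' * c \<and> y * (a * b' - a' * b) = a' * c - a * c'" for x y
    using D by algebra
  show ?thesis
  proof (rule set_eqI)
    fix p :: "real \<times> real"
    obtain x y where p: "p = (x, y)" by (cases p)
    show "p \<in> line_of (a, b, c) \<inter> line_of (a', b', c') \<longleftrightarrow> p \<in>
        {((b * c' - b' * c) / (a * b' - a' * b), (a' * c - a * c') / (a * b' - a' * b))}"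
      unfolding p Int_iff mem_line_of eq using D by (simp add: eq_divide_eq)
  qed
qed

text \<open>Inserting the Cramer point of \<open>l\<close> and \<open>m\<close> into the equation of
  \<open>n\<close> yields \<open>det3 l m n\<close> divided by \<open>cross l m\<close>.\<close>

lemma line_of_concurrent_iff:
  assumes "cross l m \<noteq> 0"
  shows "line_of l \<inter> line_of m \<subseteq> line_of n \<longleftrightarrow> det3 l m n = 0"
proof -
  obtain a b c a' b' c' a'' b'' c''
    where [simp]: "l = (a, b, c)" "m = (a', b', c')" "n = (a'', b'', c'')"
    by (metis prod_cases3)
  have D: "a * b' - a' * b \<noteq> 0"
    using assms by (simp add: cross_def)
  have "a'' * ((b * c' - b' * c) / (a * b' - a' * b)) + b'' * ((a' * c - a * c') / (a * b' - a' * b)) + c''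
      = det3 l m n / (a * b' - a' * b)"
    using D by (simp add: det3_def divide_simps) (simp add: algebra_simps)
  then show ?thesis
    using line_of_Int[of a b c a' b' c'] assms D by simp
qed

text \<open>An index is a pair of corresponding lines, so \<open>I\<close> itself carries the
  matching, and for an explicit \<open>I\<close> the hypotheses are arithmetic checks.\<close>

lemma same_combinatorics_line_of:
  assumes lines: "\<forall>(l, m)\<in>I. cross l (1, 0, 0) \<noteq> 0 \<or> cross l (0, 1, 0) \<noteq> 0"
      "\<forall>(l, m)\<in>I. cross m (1, 0, 0) \<noteq> 0 \<or> cross m (0, 1, 0) \<noteq> 0"
    and pair: "\<forall>(l, m)\<in>I. \<forall>(l', m')\<in>I. (l, m) \<noteq> (l', m') \<longrightarrow>
      cross l l' \<noteq> 0 \<and> cross m m' \<noteq> 0 \<or> parallel_distinct l l' \<and> parallel_distinct m m'"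
    and triple: "\<forall>(l, m)\<in>I. \<forall>(l', m')\<in>I. \<forall>(l'', m'')\<in>I.
      det3 l l' l'' = 0 \<longleftrightarrow> det3 m m' m'' = 0"
  shows "same_combinatorics ((line_of \<circ> fst) ` I) ((line_of \<circ> snd) ` I)"
proof (rule same_combinatoricsI)
  have is_line: "is_line (line_of l)" if "cross l (1, 0, 0) \<noteq> 0 \<or> cross l (0, 1, 0) \<noteq> 0" for l
    using that by (cases l) (auto simp: cross_def is_line_line_of)
  show L: "is_line ((line_of \<circ> fst) i) \<and> is_line ((line_of \<circ> snd) i)" if "i \<in> I" for i
    using lines(1)[rule_format, OF that] lines(2)[rule_format, OF that] is_line
    by (simp add: case_prod_beta)
  \<comment> \<open>On both sides, distinct indices give lines with at most one common point. As
    lines are infinite, this also yields injectivity.\<close>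
  have int: "(\<exists>p. line_of (fst i) \<inter> line_of (fst j) = {p}) \<and> (\<exists>p. line_of (snd i) \<inter> line_of (snd j) = {p})
      \<and> cross (fst i) (fst j) \<noteq> 0 \<and> cross (snd i) (snd j) \<noteq> 0 \<or>
      line_of (fst i) \<inter> line_of (fst j) = {} \<and> line_of (snd i) \<inter> line_of (snd j) = {}"
    if "i \<in> I" "j \<in> I" "i \<noteq> j" for i j
  proof -
    have "cross (fst i) (fst j) \<noteq> 0 \<and> cross (snd i) (snd j) \<noteq> 0 \<or>
        parallel_distinct (fst i) (fst j) \<and> parallel_distinct (snd i) (snd j)"
      using bspec[OF bspec[OF pair that(1), unfolded case_prod_beta] that(2)] that(3)
      by (simp add: case_prod_beta)
    moreover have "\<exists>p. line_of l \<inter> line_of m = {p}" if "cross l m \<noteq> 0" for l m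
      using that line_of_Int by (metis prod_cases3)
    ultimately show ?thesis
      using line_of_disjoint by metis
  qed
  have inf: "infinite (line_of (fst i)) \<and> infinite (line_of (snd i))" if "i \<in> I" for i
    using infinite_line L[OF that] by simp
  show "inj_on (line_of \<circ> fst) I"
  proof (rule inj_onI, rule ccontr)
    fix i j assume "i \<in> I" "j \<in> I" "(line_of \<circ> fst) i = (line_of \<circ> fst) j" "i \<noteq> j"
    with int[of i j] inf[of i] show False by auto
  qed
  show "inj_on (line_of \<circ> snd) I"
  proof (rule inj_onI, rule ccontr)
    fix i j assume "i \<in> I" "j \<in> I" "(line_of \<circ> snd) i = (line_of \<circ> snd) j" "i \<noteq> j"
    with int[of i j] inf[of i] show False by auto
  qed
  show "(line_of \<circ> fst) i \<inter> (line_of \<circ> fst) j \<noteq> {} \<longleftrightarrow> (line_of \<circ> snd) i \<inter> (line_of \<circ> snd) j \<noteq> {}"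
    if "i \<in> I" "j \<in> I" for i j
    using int[OF that] inf[OF that(1)] by (cases "i = j") auto
  show "(line_of \<circ> fst) i \<inter> (line_of \<circ> fst) j \<subseteq> (line_of \<circ> fst) k \<longleftrightarrow>
      (line_of \<circ> snd) i \<inter> (line_of \<circ> snd) j \<subseteq> (line_of \<circ> snd) k"
    if "i \<in> I" "j \<in> I" "k \<in> I" "(line_of \<circ> fst) i \<inter> (line_of \<circ> fst) j \<noteq> {}" "i \<noteq> j" for i j k
  proof -
    have "cross (fst i) (fst j) \<noteq> 0" "cross (snd i) (snd j) \<noteq> 0"
      using int[OF that(1,2,5)] that(4) by auto
    moreover have "det3 (fst i) (fst j) (fst k) = 0 \<longleftrightarrow> det3 (snd i) (snd j) (snd k) = 0"
      using triple that(1-3) by (simp add: case_prod_beta)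
    ultimately show ?thesis
      by (simp add: line_of_concurrent_iff)
  qed
qed

subsection \<open>The two arrangements\<close>

text \<open>A graph \<open>y = m x + k\<close> is entered as (m, -1, k), except that horizontals are
  (0, 1, -k). At \<open>t = 1\<close> the last triple no longer describes a line.\<close>

definition config :: "real \<Rightarrow> (real \<times> real \<times> real) list" where
  "config t = [(0, 1, 0), (0, 1, - t), (1, - 1, 0), (1, - 1, - 1), (t, - 1, 0),
     (1, 0, - 1), (1, 0, - t), (1 - t, 0, - 1)]"

definition arr :: "real \<Rightarrow> (real \<times> real) set set" where
  "arr t = line_of ` set (config t)"

lemma line_arrangement_arr:
  assumes "t \<noteq> 1"
  shows "line_arrangement (arr t)"
  using assms is_line_line_of by (simp add: line_arrangement_def arr_def config_def)

text \<open>Tangency to \<open>y = m x + k\<close> means \<open>m P = Q\<close> along it;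
  horizontals force \<open>Q = 0\<close> and verticals \<open>P = 0\<close>.\<close>

lemma log_fields_arr_iff:
  assumes "t \<noteq> 1"
  shows "(P, Q) \<in> log_fields (arr t) \<longleftrightarrow>
    (\<forall>x. eval2 Q (x, 0) = 0 \<and> eval2 Q (x, t) = 0 \<and> eval2 P (x, x) = eval2 Q (x, x) \<and>
      eval2 P (x, x - 1) = eval2 Q (x, x - 1) \<and> t * eval2 P (x, t * x) = eval2 Q (x, t * x)) \<and>
    (\<forall>y. eval2 P (1, y) = 0 \<and> eval2 P (t, y) = 0 \<and> eval2 P (1 / (1 - t), y) = 0)"
proof -
  have graph: "invariant_line (P, Q) (line_of (m, - 1, k)) \<longleftrightarrow>
      (\<forall>x. m * eval2 P (x, k + m * x) = eval2 Q (x, k + m * x))" for m k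
    by (simp add: invariant_line_of_iff ball_line_of)
  have horizontal: "invariant_line (P, Q) (line_of (0, 1, - k)) \<longleftrightarrow> (\<forall>x. eval2 Q (x, k) = 0)" for k
    by (simp add: invariant_line_of_iff ball_line_of)
  have vertical: "invariant_line (P, Q) (line_of (a, 0, c)) \<longleftrightarrow> (\<forall>y. eval2 P (- c / a, y) = 0)"
    if "a \<noteq> 0" for a c
    using that by (simp add: invariant_line_of_iff ball_line_of)
  show ?thesis
    unfolding log_fields_iff[OF line_arrangement_arr[OF assms]]
    using assms graph[of 1 0] graph[of 1 "- 1"] graph[of t 0] horizontal[of 0] horizontal[of t]
      vertical[of 1 "- 1"] vertical[of 1 "- t"] vertical[of "1 - t" "- 1"]
    by (simp add: arr_def config_def) blast
qed

text \<open>The entries of \<open>config (- 1)\<close> and \<open>config 2\<close>, matched position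
  by position.\<close>

definition line_pairs :: "((real \<times> real \<times> real) \<times> (real \<times> real \<times> real)) set" where
  "line_pairs = {((0, 1, 0), 0, 1, 0), ((0, 1, 1), 0, 1, - 2), ((1, - 1, 0), 1, - 1, 0),
     ((1, - 1, - 1), 1, - 1, - 1), ((- 1, - 1, 0), 2, - 1, 0), ((1, 0, - 1), 1, 0, - 1),
     ((1, 0, 1), 1, 0, - 2), ((2, 0, - 1), - 1, 0, - 1)}"

lemma same_combinatorics_arr: "same_combinatorics (arr (- 1)) (arr 2)"
proof -
  have lines: "\<forall>(l, m)\<in>line_pairs. cross l (1, 0, 0) \<noteq> 0 \<or> cross l (0, 1, 0) \<noteq> 0"
    "\<forall>(l, m)\<in>line_pairs. cross m (1, 0, 0) \<noteq> 0 \<or> cross m (0, 1, 0) \<noteq> 0"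
    unfolding line_pairs_def by (simp_all add: cross_def)
  have pair: "\<forall>(l, m)\<in>line_pairs. \<forall>(l', m')\<in>line_pairs. (l, m) \<noteq> (l', m') \<longrightarrow>
      cross l l' \<noteq> 0 \<and> cross m m' \<noteq> 0 \<or> parallel_distinct l l' \<and> parallel_distinct m m'"
    unfolding line_pairs_def
    by (simp only: ball_simps case_prod_conv) (simp add: cross_def parallel_distinct_def)
  \<comment> \<open>Repeated indices and triples of parallel lines give determinant 0 on both sides,
    so no case has to be excluded.\<close>
  have triple: "\<forall>(l, m)\<in>line_pairs. \<forall>(l', m')\<in>line_pairs. \<forall>(l'', m'')\<in>line_pairs.
      det3 l l' l'' = 0 \<longleftrightarrow> det3 m m' m'' = 0"
    unfolding line_pairs_def by (simp only: ball_simps case_prod_conv) (simp add: det3_def)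
  have "arr (- 1) = (line_of \<circ> fst) ` line_pairs" "arr 2 = (line_of \<circ> snd) ` line_pairs"
    by (simp_all add: line_pairs_def config_def arr_def)
  then show ?thesis
    using same_combinatorics_line_of[OF lines pair triple] by simp
qed

section \<open>Upper bound at \<open>t = -1\<close>\<close>

text \<open>
  Here \<open>p = x\<close> up to a constant, and \<open>Q\<close> interpolates the five values in \<open>y\<close> that the
  non-vertical lines prescribe; the term in \<open>y^4\<close> keeps \<open>Q\<close> nonzero on the verticals.
\<close>

lemma d_f_arr_special: "d_f (arr (- 1)) \<le> 4"
proof -
  \<comment> \<open>The factors x - 1, x + 1 and 2 x - 1 are the verticals; the cofactor x vanishes
    at the exceptional points (0, 0) and (0, -1).\<close>
  define P :: "real poly poly" where "P = [:[:0, 1, - 2, - 1, 2:]:]"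
  define Q :: "real poly poly" where "Q = [:0, [:1, - 2, 3:], [:0, 0, 3:], [:- 4, 2:], [:- 3:]:]"
  have P: "eval2 P (x, y) = x * (x - 1) * (x + 1) * (2 * x - 1)" for x y
    by (simp add: P_def eval2_def algebra_simps)
  have Q: "eval2 Q (x, y) = y * (y + 1) * (3 * x^2 + 2 * x * y - 3 * y^2 - 2 * x - y + 1)" for x y
    by (simp add: Q_def eval2_def algebra_simps power2_eq_square)
  have "(P, Q) \<in> log_fields (arr (- 1))"
    by (auto simp: log_fields_arr_iff P Q) algebra+
  moreover have "fixes_finitely_many_lines (P, Q)"
    \<comment> \<open>The witnesses are the verticals x = 1 and x = -1, where Q(1, 2) and Q(-1, 2)
      are nonzero, and the value P(2, 0).\<close>
    by (rule fixes_finitely_many_linesI[of 1 "- 1" P Q 2 2 2 0]) (simp_all add: P Q)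
  ultimately have "d_f (arr (- 1)) \<le> vf_degree (P, Q)"
    unfolding d_f_def by (intro Least_le) blast
  also have "\<dots> \<le> 4"
    unfolding vf_degree_def P_def Q_def
    by (auto intro!: total_degree_le simp: coeff_pCons split: nat.splits)
  finally show ?thesis .
qed

section \<open>Lower bound at \<open>t = 2\<close>\<close>

text \<open>The chain rule for \<open>f\<close> along y = s x at the origin: the two coefficients on
  the right are the partial derivatives there.\<close>

lemma coeff_restrict_1:
  "coeff (poly f [:0, s:]) 1 = coeff (coeff f 0) 1 + s * coeff (coeff f 1) 0"
proof -
  obtain g f' where f: "f = pCons g f'" by (cases f)
  obtain h f'' where f': "f' = pCons h f''" by (cases f')
  show ?thesis by (simp add: f f' coeff_pCons)
qed

text \<open>At a triple point off the verticals the linear part of the field is radial.\<close>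

lemma linear_part_at_origin:
  fixes P Q :: "real poly poly"
  assumes "t \<noteq> 0" "t \<noteq> 1" "\<And>x. eval2 Q (x, 0) = 0" "\<And>x. eval2 P (x, x) = eval2 Q (x, x)"
    "\<And>x. t * eval2 P (x, t * x) = eval2 Q (x, t * x)"
  shows "coeff (coeff P 1) 0 = 0"
proof -
  have "poly (poly Q [:0, 0:]) = poly 0"
    using assms(3) eval2_graph[of Q _ 0 0] by (intro ext) simp
  moreover have "poly (poly Q [:0, 1:]) = poly (poly P [:0, 1:])"
    using assms(4) eval2_graph[of _ _ 1 0] by (intro ext) simp
  moreover have "poly (poly Q [:0, t:]) = poly (smult t (poly P [:0, t:]))"
    using assms(5) eval2_graph[of _ _ t 0] by (intro ext) simp
  ultimately have "poly Q [:0, 0:] = 0" "poly Q [:0, 1:] = poly P [:0, 1:]"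
    "poly Q [:0, t:] = smult t (poly P [:0, t:])"
    unfolding poly_eq_poly_eq_iff by blast+
  then have "coeff (poly Q [:0, 0:]) 1 = 0" "coeff (poly Q [:0, 1:]) 1 = coeff (poly P [:0, 1:]) 1"
    "coeff (poly Q [:0, t:]) 1 = t * coeff (poly P [:0, t:]) 1"
    by (metis coeff_0, metis, metis coeff_smult)
  \<comment> \<open>Slope 0 shows that Q has no linear x-term. By slopes 1 and t, its y-coefficient
    equals both \<open>P_x + P_y\<close> and, as t is nonzero, \<open>P_x + t P_y\<close>, where
    \<open>P_x\<close>, \<open>P_y\<close> are the linear coefficients of P.\<close>
  then have "t * (t - 1) * coeff (coeff P 1) 0 = 0"
    unfolding coeff_restrict_1 by algebra
  then show ?thesis
    using assms(1,2) by simp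
qed

lemma d_f_arr_generic: "4 < d_f (arr 2)"
proof (rule ccontr)
  assume small: "\<not> 4 < d_f (arr 2)"
  \<comment> \<open>The minimum is attained because a field with finitely many invariant lines
    exists.\<close>
  have "\<exists>X\<in>log_fields (arr 2). fixes_finitely_many_lines X \<and> vf_degree X = d_f (arr 2)"
    unfolding d_f_def by (rule LeastI_ex) (use ex_finite_log_field[OF line_arrangement_arr[of 2]] in auto)
  then obtain P Q where log: "(P, Q) \<in> log_fields (arr 2)"
    and fin: "fixes_finitely_many_lines (P, Q)" and deg: "vf_degree (P, Q) = d_f (arr 2)"
    by (metis surj_pair)
  have tdeg: "total_degree P \<le> 4"
    using deg small by (simp add: vf_degree_def)
  have Q: "eval2 Q (x, 0) = 0" "eval2 Q (x, 2) = 0" "eval2 P (x, x) = eval2 Q (x, x)"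
    "eval2 P (x, x - 1) = eval2 Q (x, x - 1)" "2 * eval2 P (x, 2 * x) = eval2 Q (x, 2 * x)"
    and P: "eval2 P (1, y) = 0" "eval2 P (2, y) = 0" "eval2 P (- 1, y) = 0" for x y
    using log by (simp_all add: log_fields_arr_iff)
  \<comment> \<open>The verticals at \<open>t = 2\<close> are x = 1, x = 2 and x = 1 / (1 - 2) =
    -1.\<close>
  define V :: "real poly" where "V = [:- 1, 1:] * [:- 2, 1:] * [:1, 1:]"
  have V: "V = [:2, - 1, - 2, 1:]" by (simp add: V_def)
  have coeff_vanish: "coeff (coeff P j) i = 0" if "4 < i + j" for i j
    using coeff_above_total_degree that tdeg by fastforce
  have "\<exists>q. coeff P j = V * q" for j
  proof -
    have root: "\<exists>h. f = [:- r, 1:] * h" if "poly f r = 0" for f :: "real poly" and r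
      using that by (simp only: poly_eq_0_iff_dvd dvd_def)
    have zeros: "poly (coeff P j) 1 = 0" "poly (coeff P j) 2 = 0" "poly (coeff P j) (- 1) = 0"
      using vertical_zeros_coeff P by blast+
    obtain f where f: "coeff P j = [:- 1, 1:] * f"
      using root[OF zeros(1)] by blast
    have "poly f 2 = 0"
      using zeros(2) unfolding f by simp
    then obtain g where g: "f = [:- 2, 1:] * g"
      using root by blast
    have "poly g (- 1) = 0"
      using zeros(3) unfolding f g by simp
    then obtain h where h: "g = [:- (- 1), 1:] * h"
      using root by blast
    have "coeff P j = V * h"
      unfolding f g h V_def by (simp only: mult.assoc minus_minus)
    then show ?thesis by blast
  qed
  then obtain q where q: "\<And>j. coeff P j = V * q j" by metis
  \<comment> \<open>\<open>V\<close> uses up degree 3 of the available 4, so the cofactor with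
    y-coefficients \<open>q j\<close> has total degree at most 1.\<close>
  have deg_q: "q j = 0 \<or> degree (q j) + j \<le> 1" for j
  proof (cases "q j = 0")
    case False
    then have "degree (coeff P j) = 3 + degree (q j)"
      unfolding q by (subst degree_mult_eq) (simp_all add: V)
    moreover have "V \<noteq> 0" by (simp add: V)
    with False have "V * q j \<noteq> 0"
      by (simp only: mult_eq_0_iff simp_thms)
    then have "coeff (coeff P j) (degree (coeff P j)) \<noteq> 0"
      by (simp only: q leading_coeff_0_iff not_False_eq_True)
    ultimately show ?thesis
      using coeff_vanish[of "degree (coeff P j)" j] by linarith
  qed simp
  define a b where "a = coeff (q 0) 0" and "b = coeff (q 0) 1"
  have "degree (q 0) \<le> 1" using deg_q[of 0] by auto
  then have q0: "q 0 = [:a, b:]"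
    by (intro poly_eqI) (auto simp: a_def b_def coeff_pCons coeff_eq_0 split: nat.splits)
  have q1: "q 1 = 0 \<or> degree (q 1) = 0" using deg_q[of 1] by auto
  \<comment> \<open>Since V(0) = 2 is nonzero, the missing y-term of \<open>P\<close> is missing in
    the cofactor too, which is then \<open>a + b x\<close>.\<close>
  have "coeff (coeff P 1) 0 = 0"
    by (rule linear_part_at_origin[of 2 Q]) (use Q in simp_all)
  then have "coeff (q 1) 0 = 0"
    unfolding q by (simp add: V coeff_mult_0)
  with q1 have "q 1 = 0" by (metis leading_coeff_0_iff)
  then have q_Suc: "q (Suc j) = 0" for j
    using deg_q[of "Suc j"] by (cases j) auto
  have P0: "P = [:V * [:a, b:]:]"
  proof (rule poly_eqI)
    fix j show "coeff P j = coeff [:V * [:a, b:]:] j"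
      by (cases j) (simp_all only: q q0 q_Suc coeff_pCons_0 coeff_pCons_Suc coeff_0 mult_zero_right)
  qed
  have "eval2 P (0, 0) = 0" using Q(1,3)[of 0] by simp
  then have "a = 0" unfolding P0 by (simp add: eval2_def V)
  \<comment> \<open>(3, 2) is the crossing of y = 2 and y = x - 1, off the verticals: there V = 8
    and the cofactor is 3 b.\<close>
  have "eval2 P (3, 2) = 0" using Q(2,4)[of 3] by simp
  then have "b = 0" unfolding P0 by (simp add: eval2_def V \<open>a = 0\<close>)
  then have "P = 0" unfolding P0 using \<open>a = 0\<close> by simp
  with fst_nonzero_if_finite[OF fin] show False by simp
qed

theorem theorem4p5:
  "\<exists>\<A> \<A>'. line_arrangement \<A> \<and> line_arrangement \<A>' \<and>
     same_combinatorics \<A> \<A>' \<and> d_f \<A> \<noteq> d_f \<A>'"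
proof (intro exI conjI)
  show "line_arrangement (arr (- 1))" "line_arrangement (arr 2)"
    by (simp_all add: line_arrangement_arr)
  show "same_combinatorics (arr (- 1)) (arr 2)"
    by (rule same_combinatorics_arr)
  show "d_f (arr (- 1)) \<noteq> d_f (arr 2)"
    using d_f_arr_special d_f_arr_generic by simp
qed

end
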